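(* For every $q\in(2,\infty)$, there exists a doubling subset of $\ell_q$ (with the metric induced by the $\ell_q$-norm) that, for every $d\in\mathbb{N}$, does not admit any bi-Lipschitz embedding into $\mathbb{R}^d$.
   Context: A metric space is doubling if there is $\lambda\in\mathbb{N}$ such that every ball can be covered by at most $\lambda$ balls of half the radius. A map $f:(X,d_X)\to(Y,d_Y)$ is a bi-Lipschitz embedding if there are constants $r>0$ and $D\ge 1$ with $r\,d_X(x,y)\le d_Y(f(x),f(y))\le rD\,d_X(x,y)$ for all $x,y\in X$. $\mathbb{R}^d$ carries the Euclidean norm (equivalently, any norm). *)

theory Defs
  imports "HOL-Analysis.Analysis"
begin

section \<open>Doubling metric spaces and bi-Lipschitz embeddings\<close>

definition doubling :: "'a metric \<Rightarrow> bool" where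
  "doubling m \<longleftrightarrow>
     (\<exists>N::nat. \<forall>x\<in>mspace m. \<forall>r>0. \<exists>C. C \<subseteq> mspace m \<and> finite C \<and> card C \<le> N \<and>
        mball_of m x r \<subseteq> (\<Union>c\<in>C. mball_of m c (r / 2)))"

definition bilipschitz_embedding :: "'a metric \<Rightarrow> 'b metric \<Rightarrow> ('a \<Rightarrow> 'b) \<Rightarrow> bool" where
  "bilipschitz_embedding m m' f \<longleftrightarrow>
     f \<in> mspace m \<rightarrow> mspace m' \<and>
     (\<exists>r D. r > 0 \<and> D \<ge> 1 \<and>
        (\<forall>x\<in>mspace m. \<forall>y\<in>mspace m.
           r * mdist m x y \<le> mdist m' (f x) (f y) \<and>
           mdist m' (f x) (f y) \<le> r * D * mdist m x y))"


section \<open>The spaces \<open>\<ell>\<^sub>q\<close>\<close>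

definition lq_space :: "real \<Rightarrow> (nat \<Rightarrow> real) set" where
  "lq_space q = {x. summable (\<lambda>n. \<bar>x n\<bar> powr q)}"

definition lq_norm :: "real \<Rightarrow> (nat \<Rightarrow> real) \<Rightarrow> real" where
  "lq_norm q x = (\<Sum>n. \<bar>x n\<bar> powr q) powr (1 / q)"

text \<open>Intended for \<open>q \<ge> 1\<close> only: for other \<open>q\<close> the metric axioms can fail, and then
  \<^const>\<open>metric\<close> gives no information.\<close>

definition lq_metric :: "real \<Rightarrow> (nat \<Rightarrow> real) metric" where
  "lq_metric q = metric (lq_space q, \<lambda>x y. lq_norm q (\<lambda>n. x n - y n))"

lemma powr_convex_nonneg:
  fixes a b u v p :: real
  assumes "p \<ge> 1" "a \<ge> 0" "b \<ge> 0" "u > 0" "v > 0" "u + v = 1"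
  shows "(u * a + v * b) powr p \<le> u * a powr p + v * b powr p"
proof -
  have small: "(w * c) powr p \<le> w * c powr p" if "c \<ge> 0" "0 < w" "w < 1" for w c :: real
  proof -
    have "w powr p \<le> w powr 1"
      using that assms(1) by (intro powr_mono') auto
    then show ?thesis
      using that by (simp add: powr_mult mult_right_mono)
  qed
  consider "a = 0" | "b = 0" | "a > 0" "b > 0"
    using assms by linarith
  then show ?thesis
  proof cases
    case 1
    then show ?thesis using small[of b v] assms by simp
  next
    case 2
    then show ?thesis using small[of a u] assms by simp
  next
    case 3
    have u: "u = 1 - v" using assms by simp
    show ?thesis
      using convex_onD[OF powr_convex[OF assms(1)], of v a b] 3 assms
      by (simp add: u)
  qed
qed

lemma lq_space_add:
  assumes "q \<ge> 1" "x \<in> lq_space q" "y \<in> lq_space q"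
  shows "(\<lambda>n. x n + y n) \<in> lq_space q"
proof -
  have "summable (\<lambda>n. 2 powr q * (\<bar>x n\<bar> powr q + \<bar>y n\<bar> powr q))"
    using assms unfolding lq_space_def by (intro summable_mult summable_add) auto
  moreover have "norm (\<bar>x n + y n\<bar> powr q) \<le> 2 powr q * (\<bar>x n\<bar> powr q + \<bar>y n\<bar> powr q)" for n
  proof -
    have "\<bar>x n + y n\<bar> powr q \<le> (2 * max \<bar>x n\<bar> \<bar>y n\<bar>) powr q"
      using assms by (intro powr_mono2) auto
    also have "\<dots> = 2 powr q * (max \<bar>x n\<bar> \<bar>y n\<bar>) powr q"
      by (simp add: powr_mult)
    also have "\<dots> \<le> 2 powr q * (\<bar>x n\<bar> powr q + \<bar>y n\<bar> powr q)"
      by (intro mult_left_mono) (auto simp: max_def)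
    finally show ?thesis by simp
  qed
  ultimately show ?thesis
    unfolding lq_space_def mem_Collect_eq by (rule summable_comparison_test'[where N = 0])
qed

lemma lq_space_diff:
  assumes "q \<ge> 1" "x \<in> lq_space q" "y \<in> lq_space q"
  shows "(\<lambda>n. x n - y n) \<in> lq_space q"
  using lq_space_add[of q x "\<lambda>n. - y n"] assms by (simp add: lq_space_def)

lemma lq_norm_nonneg: "lq_norm q x \<ge> 0"
  by (simp add: lq_norm_def)

lemma lq_norm_powr:
  assumes "q \<ge> 1" "x \<in> lq_space q"
  shows "lq_norm q x powr q = (\<Sum>n. \<bar>x n\<bar> powr q)"
  using assms suminf_nonneg[of "\<lambda>n. \<bar>x n\<bar> powr q"]
  by (simp add: lq_norm_def lq_space_def powr_powr)

lemma lq_norm_eq_0_iff: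
  assumes "q \<ge> 1" "x \<in> lq_space q"
  shows "lq_norm q x = 0 \<longleftrightarrow> (\<forall>n. x n = 0)"
  using assms suminf_eq_zero_iff[of "\<lambda>n. \<bar>x n\<bar> powr q"]
  by (simp add: lq_norm_def lq_space_def)

lemma lq_norm_triangle:
  assumes q: "q \<ge> 1" and x: "x \<in> lq_space q" and y: "y \<in> lq_space q"
  shows "lq_norm q (\<lambda>n. x n + y n) \<le> lq_norm q x + lq_norm q y"
proof -
  define A B where "A = lq_norm q x" and "B = lq_norm q y"
  have xy: "(\<lambda>n. x n + y n) \<in> lq_space q"
    using assms by (rule lq_space_add)
  consider "A = 0" | "B = 0" | "A > 0" "B > 0"
    using lq_norm_nonneg[of q x] lq_norm_nonneg[of q y] by (fastforce simp: A_def B_def)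
  then show ?thesis
  proof cases
    case 1
    then show ?thesis using lq_norm_eq_0_iff[OF q x] by (simp add: A_def)
  next
    case 2
    then show ?thesis using lq_norm_eq_0_iff[OF q y] by (simp add: B_def)
  next
    case 3
    define u v where "u = A / (A + B)" and "v = B / (A + B)"
    have uv: "u > 0" "v > 0" "u + v = 1"
      using 3 by (auto simp: u_def v_def add_divide_distrib[symmetric])
    let ?g = "\<lambda>n. (A + B) powr q *
                (u * (\<bar>x n\<bar> powr q / A powr q) + v * (\<bar>y n\<bar> powr q / B powr q))"
    have le: "\<bar>x n + y n\<bar> powr q \<le> ?g n" for n
    proof -
      have "\<bar>x n + y n\<bar> powr q \<le> ((A + B) * (u * (\<bar>x n\<bar> / A) + v * (\<bar>y n\<bar> / B))) powr q"
      proof (intro powr_mono2)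
        have "(A + B) * (u * (\<bar>x n\<bar> / A) + v * (\<bar>y n\<bar> / B)) = \<bar>x n\<bar> + \<bar>y n\<bar>"
          using 3 by (simp add: u_def v_def add_divide_distrib[symmetric])
        then show "\<bar>x n + y n\<bar> \<le> (A + B) * (u * (\<bar>x n\<bar> / A) + v * (\<bar>y n\<bar> / B))"
          by simp
      qed (use q in auto)
      also have "\<dots> = (A + B) powr q * (u * (\<bar>x n\<bar> / A) + v * (\<bar>y n\<bar> / B)) powr q"
        using 3 uv by (simp add: powr_mult)
      also have "\<dots> \<le> (A + B) powr q *
                  (u * (\<bar>x n\<bar> / A) powr q + v * (\<bar>y n\<bar> / B) powr q)"
        using 3 uv q by (intro mult_left_mono powr_convex_nonneg) auto
      finally show ?thesis using 3 by (simp add: powr_divide)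
    qed
    have sx: "(\<lambda>n. \<bar>x n\<bar> powr q) sums (A powr q)"
      using x lq_norm_powr[OF q x] by (simp add: A_def lq_space_def summable_sums)
    have sy: "(\<lambda>n. \<bar>y n\<bar> powr q) sums (B powr q)"
      using y lq_norm_powr[OF q y] by (simp add: B_def lq_space_def summable_sums)
    have "?g sums ((A + B) powr q *
            (u * (A powr q / A powr q) + v * (B powr q / B powr q)))"
      by (intro sums_mult sums_add sums_divide sx sy)
    then have g: "?g sums ((A + B) powr q)"
      using 3 uv by simp
    have "lq_norm q (\<lambda>n. x n + y n) powr q = (\<Sum>n. \<bar>x n + y n\<bar> powr q)"
      using lq_norm_powr[OF q xy] by simp
    also have "\<dots> \<le> (A + B) powr q"
      using sums_le[OF le _ g] xy by (simp add: lq_space_def summable_sums)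
    finally show ?thesis
      using q 3 lq_norm_nonneg powr_less_mono2[of q "A + B" "lq_norm q (\<lambda>n. x n + y n)"]
      by (fastforce simp: A_def B_def)
  qed
qed

lemma Metric_space_lq:
  assumes q: "q \<ge> 1"
  shows "Metric_space (lq_space q) (\<lambda>x y. lq_norm q (\<lambda>n. x n - y n))"
proof
  fix x y z
  show "0 \<le> lq_norm q (\<lambda>n. x n - y n)"
    by (rule lq_norm_nonneg)
  show "lq_norm q (\<lambda>n. x n - y n) = lq_norm q (\<lambda>n. y n - x n)"
    by (simp add: lq_norm_def abs_minus_commute)
  assume x: "x \<in> lq_space q" and y: "y \<in> lq_space q"
  show "lq_norm q (\<lambda>n. x n - y n) = 0 \<longleftrightarrow> x = y"
    using lq_norm_eq_0_iff[OF q lq_space_diff[OF q x y]] by auto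
  assume z: "z \<in> lq_space q"
  show "lq_norm q (\<lambda>n. x n - z n) \<le> lq_norm q (\<lambda>n. x n - y n) + lq_norm q (\<lambda>n. y n - z n)"
    using lq_norm_triangle[OF q lq_space_diff[OF q x y] lq_space_diff[OF q y z]] by simp
qed

lemma mspace_lq_metric: "q \<ge> 1 \<Longrightarrow> mspace (lq_metric q) = lq_space q"
  by (simp add: lq_metric_def Metric_space.mspace_metric Metric_space_lq)

lemma mdist_lq_metric: "q \<ge> 1 \<Longrightarrow> mdist (lq_metric q) x y = lq_norm q (\<lambda>n. x n - y n)"
  by (simp add: lq_metric_def Metric_space.mdist_metric Metric_space_lq)


section \<open>Euclidean \<open>d\<close>-space with \<open>d\<close> a natural number\<close>

text \<open>Points are functions \<^typ>\<open>nat \<Rightarrow> real\<close> vanishing at all indices \<open>\<ge> d\<close>, so that the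
  dimension can be quantified inside a formula.\<close>

definition Rd_metric :: "nat \<Rightarrow> (nat \<Rightarrow> real) metric" where
  "Rd_metric d =
     metric (topspace (Euclidean_space d), \<lambda>x y. L2_set (\<lambda>i. x i - y i) {..<d})"

lemma Metric_space_Rd:
  "Metric_space (topspace (Euclidean_space d)) (\<lambda>x y. L2_set (\<lambda>i. x i - y i) {..<d})"
proof
  fix x y z :: "nat \<Rightarrow> real"
  show "0 \<le> L2_set (\<lambda>i. x i - y i) {..<d}"
    by simp
  show "L2_set (\<lambda>i. x i - y i) {..<d} = L2_set (\<lambda>i. y i - x i) {..<d}"
    by (simp add: L2_set_def power2_commute)
  show "L2_set (\<lambda>i. x i - z i) {..<d} \<le>
      L2_set (\<lambda>i. x i - y i) {..<d} + L2_set (\<lambda>i. y i - z i) {..<d}"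
    using L2_set_triangle_ineq[of "\<lambda>i. x i - y i" "\<lambda>i. y i - z i" "{..<d}"] by simp
  assume "x \<in> topspace (Euclidean_space d)" "y \<in> topspace (Euclidean_space d)"
  then have "x i = y i" if "i \<ge> d" for i
    using that by (simp add: topspace_Euclidean_space)
  then have "x = y" if "\<forall>i<d. x i = y i"
    using that by (metis ext not_less)
  then show "L2_set (\<lambda>i. x i - y i) {..<d} = 0 \<longleftrightarrow> x = y"
    by (auto simp: L2_set_eq_0_iff)
qed

lemma mspace_Rd_metric:
  "mspace (Rd_metric d) = {x. \<forall>i\<ge>d. x i = 0}"
  unfolding Rd_metric_def Metric_space.mspace_metric[OF Metric_space_Rd]
  by (simp add: topspace_Euclidean_space)

lemma mdist_Rd_metric:
  "mdist (Rd_metric d) x y = L2_set (\<lambda>i. x i - y i) {..<d}"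
  by (simp add: Rd_metric_def Metric_space.mdist_metric[OF Metric_space_Rd])

end

theory Submission
  imports Defs
begin

text \<open>The set consists of the points \<open>(t, \<plusminus>a\<^sub>0 \<phi>(t), \<plusminus>a\<^sub>1 \<phi>(4t), \<plusminus>a\<^sub>2 \<phi>(16t), \<dots>)\<close> with all choices of
  signs, where \<open>a\<^sub>k = \<epsilon>\<^sub>k / 4^k\<close>, \<open>\<epsilon>\<^sub>k = (k + 1)^(-1/2)\<close> and \<open>\<phi>\<close> is a 1-periodic tent supported on
  \<open>[1/4, 3/4]\<close>. Since \<open>\<Sum>\<epsilon>\<^sub>k^q\<close> converges for \<open>q > 2\<close>, each choice of signs gives a Lipschitz curve
  in \<open>t\<close>, with a uniform constant. The set is doubling: in a ball of radius \<open>r\<close>, at most one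
  \<open>a\<^sub>k\<close> much larger than \<open>r\<close> has an undetermined sign, because near an end of the support of one
  tent all tents of finer scales vanish.

  At the quarter points of a \<open>4\<close>-adic interval of level \<open>k\<close> the two signs of \<open>a\<^sub>k\<close> form a
  quadrilateral. The parallelogram inequality in Euclidean space forces the largest squared stretch
  of an embedding to grow by a multiple of \<open>\<epsilon>\<^sub>k\<^sup>2\<close> from level \<open>k\<close> to level \<open>k + 1\<close>, and
  \<open>\<Sum>\<epsilon>\<^sub>k\<^sup>2\<close> diverges. The dimension of the target plays no role.\<close>


section \<open>Norm estimates in \<open>\<ell>\<^sub>q\<close>\<close>

lemma lq_norm_le_of_sums:
  assumes "q > 0" "\<And>n. \<bar>x n\<bar> powr q \<le> g n" "g sums G"
  shows "x \<in> lq_space q" "lq_norm q x \<le> G powr (1 / q)"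
proof -
  have s: "summable (\<lambda>n. \<bar>x n\<bar> powr q)"
  proof (rule summable_comparison_test'[OF sums_summable[OF assms(3)]])
    show "norm (\<bar>x n\<bar> powr q) \<le> g n" for n
      using assms(2)[of n] by simp
  qed
  then show "x \<in> lq_space q"
    by (simp add: lq_space_def)
  have "(\<Sum>n. \<bar>x n\<bar> powr q) \<le> G"
    using sums_le[OF assms(2) summable_sums[OF s] assms(3)] .
  moreover have "(\<Sum>n. \<bar>x n\<bar> powr q) \<ge> 0"
    using s by (intro suminf_nonneg) simp_all
  ultimately show "lq_norm q x \<le> G powr (1 / q)"
    unfolding lq_norm_def using assms(1) by (intro powr_mono2) simp_all
qed

lemma lq_norm_mono:
  assumes "q \<ge> 1" "y \<in> lq_space q" "\<And>n. \<bar>x n\<bar> \<le> \<bar>y n\<bar>"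
  shows "x \<in> lq_space q" "lq_norm q x \<le> lq_norm q y"
proof -
  have "(\<lambda>n. \<bar>y n\<bar> powr q) sums (lq_norm q y powr q)"
    using assms(2) lq_norm_powr[OF assms(1,2)] by (simp add: lq_space_def summable_sums)
  moreover have "\<bar>x n\<bar> powr q \<le> \<bar>y n\<bar> powr q" for n
    using assms(1,3) by (intro powr_mono2) simp_all
  ultimately have *: "x \<in> lq_space q" "lq_norm q x \<le> (lq_norm q y powr q) powr (1 / q)"
    using lq_norm_le_of_sums[of q x "\<lambda>n. \<bar>y n\<bar> powr q"] assms(1) by simp_all
  then show "x \<in> lq_space q" "lq_norm q x \<le> lq_norm q y"
    using assms(1) by (simp_all add: powr_powr lq_norm_nonneg)
qed

lemma lq_norm_scale:
  assumes "q \<ge> 1" "x \<in> lq_space q"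
  shows "(\<lambda>n. c * x n) \<in> lq_space q" "lq_norm q (\<lambda>n. c * x n) = \<bar>c\<bar> * lq_norm q x"
proof -
  have *: "(\<lambda>n. \<bar>c * x n\<bar> powr q) = (\<lambda>n. \<bar>c\<bar> powr q * \<bar>x n\<bar> powr q)"
    by (simp add: abs_mult powr_mult)
  show "(\<lambda>n. c * x n) \<in> lq_space q"
    using assms by (simp add: lq_space_def *)
  show "lq_norm q (\<lambda>n. c * x n) = \<bar>c\<bar> * lq_norm q x"
    using assms by (simp add: lq_norm_def lq_space_def * suminf_mult suminf_nonneg powr_mult powr_powr)
qed

lemma abs_coordinate_le_lq_norm:
  assumes "q \<ge> 1" "x \<in> lq_space q"
  shows "\<bar>x n\<bar> \<le> lq_norm q x"
proof -
  have "\<bar>x n\<bar> powr q \<le> (\<Sum>n. \<bar>x n\<bar> powr q)"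
    using sum_le_suminf[of "\<lambda>n. \<bar>x n\<bar> powr q" "{n}"] assms by (simp add: lq_space_def)
  then have "(\<bar>x n\<bar> powr q) powr (1 / q) \<le> lq_norm q x"
    unfolding lq_norm_def using assms by (intro powr_mono2) auto
  then show ?thesis
    using assms by (simp add: powr_powr)
qed

text \<open>Entries in [0, 1] only shrink under the power \<open>q\<close>, so the geometric series
  bounds the norm uniformly in \<open>q\<close> and \<open>K\<close>. This sequence later dominates
  the coordinates of small height.\<close>

lemma lq_norm_geometric_tail:
  assumes "q \<ge> 1"
  shows "(\<lambda>n. if n < K then 0 else (1 / 4) ^ (n - K)) \<in> lq_space q"
    and "lq_norm q (\<lambda>n. if n < K then 0 else (1 / 4) ^ (n - K)) \<le> 2"
proof -
  let ?x = "\<lambda>n. if n < K then 0 else (1 / 4) ^ (n - K) :: real"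
  have sums: "?x sums (4 / 3)"
    using geometric_sums[of "1 / 4 :: real"] sums_iff_shift[of ?x K "4 / 3"] by simp
  have le: "\<bar>?x n\<bar> powr q \<le> ?x n" for n
  proof -
    have x: "0 \<le> ?x n" "?x n \<le> 1"
      by (simp_all add: power_le_one)
    then have "?x n powr q \<le> ?x n powr 1"
      using assms by (intro powr_mono') simp_all
    then show ?thesis
      using x by simp
  qed
  note * = lq_norm_le_of_sums[OF _ le sums]
  show "?x \<in> lq_space q"
    using assms by (intro *) auto
  have "lq_norm q ?x \<le> (4 / 3) powr (1 / q)"
    using assms by (intro *) auto
  also have "\<dots> \<le> (4 / 3) powr 1"
    using assms by (intro powr_mono) auto
  finally show "lq_norm q ?x \<le> 2"
    by simp
qed

text \<open>One representative per label serves as a centre. The labelling \<open>F\<close> may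
  depend on the ball; only the number of labels is uniform.\<close>

lemma doublingI_labelling:
  assumes "\<And>x r. x \<in> mspace m \<Longrightarrow> r > 0 \<Longrightarrow>
    \<exists>(F :: 'a \<Rightarrow> 'l) V. finite V \<and> card V \<le> N \<and> F ` mball_of m x r \<subseteq> V \<and>
      (\<forall>y \<in> mball_of m x r. \<forall>z \<in> mball_of m x r. F y = F z \<longrightarrow> mdist m y z < r / 2)"
  shows "doubling m"
  unfolding doubling_def
proof (intro exI[of _ N] ballI allI impI)
  fix x and r :: real
  assume "x \<in> mspace m" "r > 0"
  from assms[OF this] obtain F :: "'a \<Rightarrow> 'l" and V where V: "finite V" "card V \<le> N" "F ` mball_of m x r \<subseteq> V"
    and F: "\<forall>y \<in> mball_of m x r. \<forall>z \<in> mball_of m x r. F y = F z \<longrightarrow> mdist m y z < r / 2"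
    by blast
  let ?B = "mball_of m x r"
  let ?C = "inv_into ?B F ` (F ` ?B)"
  have "?C \<subseteq> ?B"
    by (auto intro: inv_into_into simp del: in_mball_of)
  moreover have "?B \<subseteq> mspace m"
    by auto
  ultimately have "?C \<subseteq> mspace m"
    by (rule subset_trans)
  moreover have "finite (F ` ?B)" "card (F ` ?B) \<le> N"
    using V finite_subset card_mono[OF V(1,3)] by auto
  then have "finite ?C" "card ?C \<le> N"
    using card_image_le[of "F ` ?B" "inv_into ?B F"] by auto
  moreover have "?B \<subseteq> (\<Union>c\<in>?C. mball_of m c (r / 2))"
  proof
    fix y assume y: "y \<in> ?B"
    let ?c = "inv_into ?B F (F y)"
    have "?c \<in> ?B" "F ?c = F y"
      using y by (auto intro: inv_into_into f_inv_into_f simp del: in_mball_of)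
    then have "y \<in> mball_of m ?c (r / 2)"
      using F y by (metis in_mball_of)
    then show "y \<in> (\<Union>c\<in>?C. mball_of m c (r / 2))"
      using y by blast
  qed
  ultimately show "\<exists>C\<subseteq>mspace m. finite C \<and> card C \<le> N \<and> ?B \<subseteq> (\<Union>c\<in>C. mball_of m c (r / 2))"
    by (intro exI[of _ ?C]) simp
qed


section \<open>The doubling set\<close>

definition bump :: "real \<Rightarrow> real" where
  "bump x = max 0 (infdist x \<int> - 1 / 4)"

lemma bump_nonneg: "bump x \<ge> 0"
  by (simp add: bump_def)

lemma bump_lipschitz: "\<bar>bump x - bump y\<bar> \<le> \<bar>x - y\<bar>"
  using infdist_triangle_abs[of x \<int> y] by (auto simp: bump_def dist_real_def)

lemma infdist_Ints_attained:
  obtains m :: real where "m \<in> \<int>" "infdist x \<int> = \<bar>x - m\<bar>"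
proof -
  have "(\<int> :: real set) \<noteq> {}"
    using Ints_0 by blast
  then obtain m :: real where "m \<in> \<int>" "infdist x \<int> = dist x m"
    using infdist_attains_inf[OF closed_Ints] by metis
  then show thesis
    using that by (simp add: dist_real_def)
qed

text \<open>Multiplication by \<open>4 ^ j\<close> maps integers to integers, so a nearest integer
  of \<open>x\<close> gives a candidate for \<open>4 ^ j * x\<close>.\<close>

lemma infdist_Ints_scale: "infdist (4 ^ j * x) \<int> \<le> 4 ^ j * infdist (x :: real) \<int>"
proof -
  obtain m :: real where m: "m \<in> \<int>" "infdist x \<int> = \<bar>x - m\<bar>"
    by (rule infdist_Ints_attained)
  have "dist (4 ^ j * x) (4 ^ j * m) = 4 ^ j * \<bar>x - m\<bar>"
    by (simp add: dist_real_def abs_mult flip: right_diff_distrib)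
  with m show ?thesis
    by (intro infdist_le2[of "4 ^ j * m"]) auto
qed

lemma bump_le: "bump x \<le> 1 / 4"
proof -
  have "infdist x \<int> \<le> \<bar>x - of_int (round x)\<bar>"
    using infdist_le[of "of_int (round x)" \<int> x] by (simp add: dist_real_def)
  also have "\<dots> \<le> 1 / 2"
    using of_int_round_abs_le[of x] by (simp add: abs_minus_commute)
  finally show ?thesis
    by (auto simp: bump_def max_def)
qed

lemma bump_of_int [simp]: "bump (of_int m) = 0"
  by (simp add: bump_def)

lemma bump_quarter: "\<bar>x - of_int m\<bar> \<le> 1 / 4 \<Longrightarrow> bump x = 0"
  using infdist_le2[of "of_int m :: real" \<int> x "1 / 4"] by (simp add: bump_def dist_real_def)

lemma bump_half: "bump (of_int m + 1 / 2) = 1 / 4"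
proof -
  let ?x = "of_int m + 1 / 2 :: real"
  obtain k :: real where k: "k \<in> \<int>" "infdist ?x \<int> = \<bar>?x - k\<bar>"
    by (rule infdist_Ints_attained)
  then obtain i where i: "k = of_int i"
    by (auto elim: Ints_cases)
  have "\<bar>?x - k\<bar> \<ge> 1 / 2"
  proof (cases "i \<le> m")
    case True
    then have "k \<le> of_int m"
      by (simp add: i)
    then show ?thesis
      by linarith
  next
    case False
    then have "of_int (m + 1) \<le> k"
      unfolding i of_int_le_iff by simp
    then show ?thesis
      by (simp add: abs_if)
  qed
  then have "bump ?x \<ge> 1 / 4"
    using k by (simp add: bump_def)
  with bump_le[of ?x] show ?thesis
    by simp
qed

text \<open>Where a bump starts to grow, all bumps of finer scales vanish; this separation of
  scales makes the set below doubling.\<close>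

lemma infdist_Ints_of_bump_pos:
  assumes "bump x > 0"
  shows "infdist (4 ^ Suc j * x) \<int> \<le> 4 ^ Suc j * bump x"
proof -
  obtain m :: real where m: "m \<in> \<int>" "infdist x \<int> = \<bar>x - m\<bar>"
    by (rule infdist_Ints_attained)
  have b: "bump x = \<bar>x - m\<bar> - 1 / 4"
    using assms m by (auto simp: bump_def)
  \<comment> \<open>The support of the tent ends at \<open>m + 1 / 4\<close> or
    \<open>m - 1 / 4\<close>, which scaling by 4 turns into the integers \<open>4 * m + 1\<close>
    and \<open>4 * m - 1\<close>. As the tent has slope 1, \<open>bump x\<close> is the distance
    from \<open>x\<close> to that end.\<close>
  have "infdist (4 * x) \<int> \<le> 4 * bump x"
  proof (cases "x \<ge> m")
    case True
    have "4 * m + 1 \<in> \<int>"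
      using m by auto
    then show ?thesis
      using True b assms by (intro infdist_le2[of "4 * m + 1"]) (auto simp: dist_real_def)
  next
    case False
    have "4 * m - 1 \<in> \<int>"
      using m by auto
    then show ?thesis
      using False b assms by (intro infdist_le2[of "4 * m - 1"]) (auto simp: dist_real_def)
  qed
  then have "4 ^ j * infdist (4 * x) \<int> \<le> 4 ^ j * (4 * bump x)"
    by simp
  with infdist_Ints_scale[of j "4 * x"] have "infdist (4 ^ j * (4 * x)) \<int> \<le> 4 ^ j * (4 * bump x)"
    by (rule order_trans)
  then show ?thesis
    by (simp only: power_Suc2 mult.assoc)
qed

section \<open>Signed tent curves and their Lipschitz constants\<close>

definition slope :: "nat \<Rightarrow> real" where
  "slope k = 1 / sqrt (real (Suc k))"

definition height :: "nat \<Rightarrow> real" where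
  "height k = slope k / 4 ^ k"

lemma slope_pos: "slope k > 0"
  by (simp add: slope_def)

lemma slope_antimono: "j \<le> k \<Longrightarrow> slope k \<le> slope j"
  by (simp add: slope_def frac_le)

lemma slope_le_1: "slope k \<le> 1"
  by (simp add: slope_def)

lemma height_pos: "height k > 0"
  by (simp add: height_def slope_pos)

lemma height_decay:
  assumes "j \<le> k"
  shows "height k \<le> height j * (1 / 4) ^ (k - j)"
proof -
  have "height j * (1 / 4) ^ (k - j) = slope j / 4 ^ k"
    using assms by (simp add: height_def power_diff field_simps)
  then show ?thesis
    using slope_antimono[OF assms] by (simp add: height_def divide_right_mono)
qed

fun pt :: "real \<Rightarrow> (nat \<Rightarrow> real) \<Rightarrow> nat \<Rightarrow> real" where
  "pt t s 0 = t"
| "pt t s (Suc k) = s k * (height k * bump (4 ^ k * t))"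

definition bump_set :: "(nat \<Rightarrow> real) set" where
  "bump_set = {pt t s | t s. \<forall>k. \<bar>s k\<bar> = 1}"

text \<open>These are coordinatewise Lipschitz constants of the curve \<open>pt t s\<close> in
  \<open>t\<close>, valid for every choice of signs; its norm is therefore a common Lipschitz
  constant of all the curves.\<close>

fun modulus :: "nat \<Rightarrow> real" where
  "modulus 0 = 1"
| "modulus (Suc k) = slope k"

text \<open>The q-th powers of the slopes are the terms of a p-series with exponent
  \<open>q / 2 > 1\<close>.\<close>

lemma modulus_in_lq_space:
  assumes "q > 2"
  shows "modulus \<in> lq_space q"
proof -
  have "summable (\<lambda>n. real n powr (- q / 2))"
    using assms by (subst summable_real_powr_iff) simp
  then have "summable (\<lambda>n. real (Suc n) powr (- q / 2))"
    by (subst summable_Suc_iff)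
  moreover have "slope n powr q = real (Suc n) powr (- q / 2)" for n
    by (simp add: slope_def powr_half_sqrt[symmetric] powr_divide powr_powr powr_minus_divide
      del: of_nat_Suc)
  ultimately have "summable (\<lambda>n. \<bar>modulus (Suc n)\<bar> powr q)"
    using slope_pos by (simp add: abs_of_pos)
  then show ?thesis
    unfolding lq_space_def mem_Collect_eq by (subst (asm) summable_Suc_iff)
qed

lemma height_bump_lipschitz:
  "\<bar>height k * bump (4 ^ k * t) - height k * bump (4 ^ k * u)\<bar> \<le> slope k * \<bar>t - u\<bar>"
proof -
  have "\<bar>bump (4 ^ k * t) - bump (4 ^ k * u)\<bar> \<le> 4 ^ k * \<bar>t - u\<bar>"
    using bump_lipschitz[of "4 ^ k * t" "4 ^ k * u"] by (simp add: abs_mult flip: right_diff_distrib)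
  then have "height k * \<bar>bump (4 ^ k * t) - bump (4 ^ k * u)\<bar> \<le> height k * (4 ^ k * \<bar>t - u\<bar>)"
    using height_pos[of k] by (simp add: mult_left_mono)
  moreover have "height k * (4 ^ k * \<bar>t - u\<bar>) = slope k * \<bar>t - u\<bar>"
    by (simp add: height_def)
  ultimately show ?thesis
    using height_pos[of k] by (simp add: abs_mult flip: right_diff_distrib)
qed

lemma abs_pt_Suc:
  assumes "\<bar>s k\<bar> = 1"
  shows "\<bar>pt t s (Suc k)\<bar> = height k * bump (4 ^ k * t)"
  using assms height_pos[of k] bump_nonneg by (simp add: abs_mult)

lemma pt_diff_le:
  assumes "\<And>k. \<bar>s k\<bar> = 1"
  shows "\<bar>pt t s n - pt u s n\<bar> \<le> \<bar>\<bar>t - u\<bar> * modulus n\<bar>"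
proof (cases n)
  case (Suc k)
  have "\<bar>pt t s n - pt u s n\<bar> = \<bar>height k * bump (4 ^ k * t) - height k * bump (4 ^ k * u)\<bar>"
    using assms[of k] by (simp add: Suc abs_mult flip: right_diff_distrib)
  then show ?thesis
    using height_bump_lipschitz[of k t u] slope_pos[of k] by (simp add: Suc abs_mult mult.commute)
qed simp

lemma lq_norm_pt_diff_le:
  assumes "q > 2" "\<And>k. \<bar>s k\<bar> = 1"
  shows "(\<lambda>n. pt t s n - pt u s n) \<in> lq_space q"
    and "lq_norm q (\<lambda>n. pt t s n - pt u s n) \<le> \<bar>t - u\<bar> * lq_norm q modulus"
  using lq_norm_mono[of q "\<lambda>n. \<bar>t - u\<bar> * modulus n" "\<lambda>n. pt t s n - pt u s n"]
    lq_norm_scale[OF _ modulus_in_lq_space, of q "\<bar>t - u\<bar>"] pt_diff_le[of s t _ u] assms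
  by auto

lemma pt_zero: "pt 0 s n = 0"
  using bump_of_int[of 0] by (cases n) auto

lemma bump_set_subset:
  assumes "q > 2"
  shows "bump_set \<subseteq> lq_space q"
  \<comment> \<open>All curves pass through the zero sequence at parameter 0, so membership is the
    difference estimate with \<open>u = 0\<close>.\<close>
  using lq_norm_pt_diff_le(1)[OF assms, of _ _ 0] by (auto simp: bump_set_def pt_zero)

section \<open>Separation of scales\<close>

text \<open>A small positive value at level \<open>k\<close> places \<open>t\<close> within
  \<open>2 * r / slope k\<close> of an end of a tent support, which \<open>4 ^ k'\<close> maps to an
  integer. So \<open>4 ^ k' * u\<close> is within \<open>4 ^ k' * (4 * r / slope k')\<close> of an
  integer, while positivity of the finer tent requires distance above 1/4; comparing the two gives
  the factor 16.\<close>

lemma height_lt_of_crossing: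
  assumes "k < k'" "bump (4 ^ k * t) > 0" "height k * bump (4 ^ k * t) \<le> 2 * r"
    and "bump (4 ^ k' * u) > 0" "\<bar>t - u\<bar> \<le> 2 * r"
  shows "height k' < 16 * r"
proof -
  obtain j where k': "k' = k + Suc j"
    using assms(1) less_iff_Suc_add by auto
  have r: "r \<ge> 0"
    using assms(5) by linarith
  have "bump (4 ^ k * t) \<le> 2 * r / height k"
    using assms(3) height_pos[of k] by (simp add: pos_le_divide_eq mult.commute)
  also have "\<dots> = 4 ^ k * (2 * r / slope k)"
    by (simp add: height_def)
  also have "\<dots> \<le> 4 ^ k * (2 * r / slope k')"
    using slope_antimono[of k k'] slope_pos[of k'] r assms(1)
    by (intro mult_left_mono divide_left_mono mult_pos_pos slope_pos) simp_all
  finally have "4 ^ Suc j * bump (4 ^ k * t) \<le> 4 ^ Suc j * (4 ^ k * (2 * r / slope k'))"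
    by (intro mult_left_mono) simp_all
  moreover have "infdist (4 ^ k' * t) \<int> \<le> 4 ^ Suc j * bump (4 ^ k * t)"
    using infdist_Ints_of_bump_pos[OF assms(2), of j]
    by (simp add: k' power_add mult.assoc mult.left_commute)
  ultimately have "infdist (4 ^ k' * t) \<int> \<le> 4 ^ k' * (2 * r / slope k')"
    by (simp add: k' power_add mult.assoc mult.left_commute)
  moreover have "infdist (4 ^ k' * u) \<int> \<le> infdist (4 ^ k' * t) \<int> + 4 ^ k' * \<bar>t - u\<bar>"
    using infdist_triangle[of "4 ^ k' * u" \<int> "4 ^ k' * t"]
    by (simp add: dist_real_def abs_mult abs_minus_commute flip: right_diff_distrib)
  moreover have "1 / 4 < infdist (4 ^ k' * u) \<int>"
    using assms(4) by (simp add: bump_def max_def split: if_splits)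
  moreover have "4 ^ k' * \<bar>t - u\<bar> \<le> 4 ^ k' * (2 * r / slope k')"
  proof (intro mult_left_mono)
    have "2 * r * slope k' \<le> 2 * r"
      using r slope_le_1[of k'] by (simp add: mult_left_le)
    then have "2 * r \<le> 2 * r / slope k'"
      using slope_pos[of k'] by (simp add: pos_le_divide_eq)
    with assms(5) show "\<bar>t - u\<bar> \<le> 2 * r / slope k'"
      by linarith
  qed simp
  ultimately have "1 / 4 < 4 ^ k' * (2 * r / slope k') + 4 ^ k' * (2 * r / slope k')"
    by linarith
  then show ?thesis
    using slope_pos[of k'] by (simp add: height_def field_simps)
qed

text \<open>Only the least level \<open>a\<close> escapes the upper bound. From the second least
  level \<open>b\<close> on, four further levels divide the height by at least 256, more than 128,
  so \<open>T\<close> lies in \<open>a\<close> together with a window of four levels.\<close>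

lemma card_height_le:
  assumes "\<delta> > 0" and ge: "\<And>k. k \<in> T \<Longrightarrow> height k \<ge> \<delta>"
    and lt: "\<And>k k'. k \<in> T \<Longrightarrow> k' \<in> T \<Longrightarrow> k < k' \<Longrightarrow> height k' < 128 * \<delta>"
  shows "finite T" "card T \<le> 5"
proof -
  have "\<exists>a b. T \<subseteq> insert a {b..<b + 4}"
  proof (cases "\<exists>a. T \<subseteq> {a}")
    case False
    define a where "a = (LEAST a. a \<in> T)"
    define b where "b = (LEAST b. b \<in> T - {a})"
    have "\<exists>a. a \<in> T" "\<exists>b. b \<in> T - {a}"
      using False by blast+
    then have a: "a \<in> T" and b: "b \<in> T - {a}"
      unfolding a_def b_def by (metis LeastI_ex)+
    have "a \<le> b"
      unfolding a_def using b by (intro Least_le) simp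
    then have hb: "height b < 128 * \<delta>"
      using a b by (intro lt[of a b]) auto
    have "k \<in> insert a {b..<b + 4}" if k: "k \<in> T" for k
    proof (rule ccontr)
      assume k': "k \<notin> insert a {b..<b + 4}"
      moreover have "k \<noteq> a \<Longrightarrow> b \<le> k"
        unfolding b_def using k by (intro Least_le) simp
      ultimately have bk: "b + 4 \<le> k"
        by auto
      have "\<delta> \<le> height k"
        using k by (rule ge)
      also have "\<dots> \<le> height b * (1 / 4) ^ (k - b)"
        using bk by (intro height_decay) simp
      also have "\<dots> \<le> height b * (1 / 4) ^ 4"
        using bk height_pos[of b] by (intro mult_left_mono power_decreasing) auto
      also have "\<dots> < \<delta>"
        using hb \<open>\<delta> > 0\<close> by (simp add: power4_eq_xxxx)
      finally show False
        by simp
    qed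
    then show ?thesis
      by blast
  qed blast
  then obtain a b where T: "T \<subseteq> insert a {b..<b + 4}"
    by blast
  then show "finite T"
    by (rule finite_subset) simp
  have "card T \<le> card (insert a {b..<b + 4})"
    using T by (intro card_mono) simp_all
  also have "\<dots> \<le> 5"
    using card_insert_le_m1[of 5 "{b..<b + 4}" a] by simp
  finally show "card T \<le> 5" .
qed

section \<open>Distances between points without opposite signs at large heights\<close>

lemma exists_height_less:
  assumes "\<delta> > 0"
  shows "\<exists>k. height k < \<delta>"
proof -
  obtain k where "(1 / 4) ^ k < \<delta>"
    using real_arch_pow_inv[OF assms, of "1 / 4"] by auto
  moreover have "height k \<le> (1 / 4) ^ k"
    using height_decay[of 0 k] by (simp add: height_def slope_def)
  ultimately show ?thesis
    by (intro exI[of _ k]) linarith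
qed

text \<open>Where signs do not conflict, the difference equals that of the absolute values, as if
  both points lay on one curve. From the first level \<open>K\<close> of height below
  \<open>\<delta>\<close> on, the two tent values add up to at most \<open>height k / 2\<close>;
  this tail is \<open>\<delta> / 2\<close> times a geometric sequence of norm at most 2.\<close>

lemma lq_norm_pt_diff_le_of_same_sign:
  assumes q: "q > 2" and s: "\<And>k. \<bar>s k\<bar> = 1" "\<And>k. \<bar>s' k\<bar> = 1" and "\<delta> > 0"
    and sign: "\<And>k. height k \<ge> \<delta> \<Longrightarrow> pt t s (Suc k) * pt u s' (Suc k) \<ge> 0"
  shows "lq_norm q (\<lambda>n. pt t s n - pt u s' n) \<le> \<bar>t - u\<bar> * lq_norm q modulus + \<delta>"
proof -
  define K where "K = (LEAST k. height k < \<delta>)"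
  have K: "height K < \<delta>"
    unfolding K_def using exists_height_less[OF \<open>\<delta> > 0\<close>] by (rule LeastI_ex)
  have below: "height k \<ge> \<delta>" if "k < K" for k
    using not_less_Least[OF that[unfolded K_def]] by simp
  define g :: "nat \<Rightarrow> real" where "g n = (if n < Suc K then 0 else (1 / 4) ^ (n - Suc K))" for n
  have q1: "q \<ge> 1"
    using q by simp
  have g: "g \<in> lq_space q" "lq_norm q g \<le> 2"
    using lq_norm_geometric_tail[OF q1, of "Suc K"] by (simp_all add: g_def[abs_def])
  have le: "\<bar>pt t s n - pt u s' n\<bar> \<le> \<bar>\<bar>t - u\<bar> * modulus n + \<delta> / 2 * g n\<bar>" for n
  proof (cases n)
    case (Suc k)
    note abs = abs_pt_Suc[of s k t, OF s(1)] abs_pt_Suc[of s' k u, OF s(2)]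
    have nonneg: "0 \<le> slope k * \<bar>t - u\<bar>" "0 \<le> \<delta> / 2 * g n"
      using slope_pos[of k] \<open>\<delta> > 0\<close> by (simp_all add: g_def)
    have "\<bar>pt t s n - pt u s' n\<bar> \<le> slope k * \<bar>t - u\<bar> + \<delta> / 2 * g n"
    proof (cases "k < K")
      case True
      have "\<bar>pt t s n - pt u s' n\<bar> = \<bar>\<bar>pt t s n\<bar> - \<bar>pt u s' n\<bar>\<bar>"
        using sign[OF below[OF True]] unfolding Suc by (auto simp: zero_le_mult_iff)
      also have "\<dots> \<le> slope k * \<bar>t - u\<bar>"
        unfolding Suc abs by (rule height_bump_lipschitz)
      finally show ?thesis
        using nonneg(2) by linarith
    next
      case False
      have "\<bar>pt t s n - pt u s' n\<bar> \<le> height k * bump (4 ^ k * t) + height k * bump (4 ^ k * u)"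
        unfolding Suc abs[symmetric] by (rule abs_triangle_ineq4)
      also have "\<dots> \<le> height k * (1 / 4) + height k * (1 / 4)"
        using height_pos[of k] by (intro add_mono mult_left_mono bump_le) simp_all
      also have "\<dots> \<le> height K * (1 / 4) ^ (k - K) / 2"
        using height_decay[of K k] False by simp
      also have "\<dots> \<le> \<delta> / 2 * g n"
        using K False by (simp add: g_def Suc)
      finally show ?thesis
        using nonneg(1) by linarith
    qed
    then show ?thesis
      by (simp add: Suc mult.commute)
  qed (simp add: g_def)
  note M = lq_norm_scale[OF q1 modulus_in_lq_space[OF q], of "\<bar>t - u\<bar>"]
  note G = lq_norm_scale[OF q1 g(1), of "\<delta> / 2"]
  have "lq_norm q (\<lambda>n. pt t s n - pt u s' n) \<le> lq_norm q (\<lambda>n. \<bar>t - u\<bar> * modulus n + \<delta> / 2 * g n)"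
    by (rule lq_norm_mono(2)[OF q1 lq_space_add[OF q1 M(1) G(1)] le])
  also have "\<dots> \<le> \<bar>t - u\<bar> * lq_norm q modulus + \<delta> / 2 * lq_norm q g"
    using lq_norm_triangle[OF q1 M(1) G(1)] \<open>\<delta> > 0\<close> unfolding M(2) G(2) by simp
  also have "\<dots> \<le> \<bar>t - u\<bar> * lq_norm q modulus + \<delta>"
    using g(2) \<open>\<delta> > 0\<close> by simp
  finally show ?thesis .
qed

section \<open>The doubling property\<close>

lemma abs_coordinate_diff_le:
  assumes "q > 2" "y \<in> bump_set" "z \<in> bump_set"
  shows "\<bar>y n - z n\<bar> \<le> lq_norm q (\<lambda>n. y n - z n)"
  using abs_coordinate_le_lq_norm[OF _ lq_space_diff, of q y z n] bump_set_subset[OF assms(1)] assms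
  by auto

text \<open>Opposite signs force the value at level \<open>k\<close> to be at most the distance of
  \<open>y\<close> and \<open>z\<close>, which is the smallness needed for
  \<open>height_lt_of_crossing\<close>. A third point \<open>y'\<close> is allowed because different
  levels may have different witnesses.\<close>

lemma height_lt_of_two_crossings:
  assumes q: "q > 2" and "k < k'"
    and S: "y \<in> bump_set" "z \<in> bump_set" "y' \<in> bump_set"
    and le: "lq_norm q (\<lambda>n. y n - z n) \<le> 2 * r" "lq_norm q (\<lambda>n. y n - y' n) \<le> 2 * r"
    and opp: "y (Suc k) * z (Suc k) < 0" and "y' (Suc k') \<noteq> 0"
  shows "height k' < 16 * r"
proof -
  obtain t s where y: "y = pt t s" "\<bar>s k\<bar> = 1"
    using S(1) by (auto simp: bump_set_def)
  obtain u s' where y': "y' = pt u s'" "\<bar>s' k'\<bar> = 1"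
    using S(3) by (auto simp: bump_set_def)
  have pos: "\<And>x. bump x \<noteq> 0 \<Longrightarrow> bump x > 0"
    using bump_nonneg by (simp add: order_less_le)
  show ?thesis
  proof (rule height_lt_of_crossing[OF \<open>k < k'\<close>])
    show "bump (4 ^ k * t) > 0"
      using opp by (intro pos) (auto simp: y)
    have "\<bar>y (Suc k)\<bar> \<le> \<bar>y (Suc k) - z (Suc k)\<bar>"
      using opp unfolding mult_less_0_iff by linarith
    also have "\<dots> \<le> 2 * r"
      using abs_coordinate_diff_le[OF q S(1,2)] le(1) by (rule order_trans)
    finally show "height k * bump (4 ^ k * t) \<le> 2 * r"
      using abs_pt_Suc[of s k t] y by simp
    show "bump (4 ^ k' * u) > 0"
      using \<open>y' (Suc k') \<noteq> 0\<close> by (intro pos) (auto simp: y')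
    show "\<bar>t - u\<bar> \<le> 2 * r"
      using order_trans[OF abs_coordinate_diff_le[OF q S(1,3), of 0] le(2)] by (simp add: y y')
  qed
qed

lemma floor_divide_eq_imp_diff_less:
  fixes a b w :: real
  assumes "\<lfloor>a / w\<rfloor> = \<lfloor>b / w\<rfloor>" "w > 0"
  shows "\<bar>a - b\<bar> < w"
proof -
  have "\<bar>a / w - b / w\<bar> < 1"
    using assms(1) by linarith
  then have "\<bar>a - b\<bar> / w < 1"
    using assms(2) by (simp add: abs_divide flip: diff_divide_distrib)
  then show ?thesis
    using assms(2) by simp
qed

lemma floor_divide_mem_of_diff_less:
  fixes a b r :: real
  assumes "\<bar>a - b\<bar> < r" "w > 0"
  shows "\<lfloor>a / w\<rfloor> \<in> {\<lfloor>b / w\<rfloor> - \<lceil>r / w\<rceil>..\<lfloor>b / w\<rfloor> + \<lceil>r / w\<rceil> + 1}"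
proof -
  have "\<bar>a / w - b / w\<bar> < r / w"
    using assms by (simp add: abs_divide divide_strict_right_mono flip: diff_divide_distrib)
  then show ?thesis
    unfolding atLeastAtMost_iff by linarith
qed

lemma doubling_bump_set:
  assumes q: "q > 2"
  shows "doubling (submetric (lq_metric q) bump_set)"
proof -
  have q1: "q \<ge> 1"
    using q by simp
  let ?m = "submetric (lq_metric q) bump_set"
  have space: "mspace ?m = bump_set"
    using bump_set_subset[OF q] by (auto simp: mspace_lq_metric[OF q1])
  define C where "C = lq_norm q modulus"
  have C: "C \<ge> 1"
    using abs_coordinate_le_lq_norm[OF q1 modulus_in_lq_space[OF q], of 0] by (simp add: C_def)
  \<comment> \<open>The first factor counts intervals of the parameter, the second the sign patterns
    on at most five levels.\<close>
  define N where "N = nat (2 * \<lceil>8 * C\<rceil> + 2) * 2 ^ 5"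
  show ?thesis
  proof (rule doublingI_labelling)
    fix x :: "nat \<Rightarrow> real" and r :: real
    assume x: "x \<in> mspace ?m" and r: "r > 0"
    let ?B = "mball_of ?m x r"
    have B: "y \<in> ?B \<longleftrightarrow> y \<in> bump_set \<and> lq_norm q (\<lambda>n. x n - y n) < r" for y
      using x by (simp only: in_mball_of space mdist_submetric mdist_lq_metric[OF q1]) simp
    have B2: "lq_norm q (\<lambda>n. y n - z n) \<le> 2 * r" if "y \<in> ?B" "z \<in> ?B" for y z
    proof -
      have "x \<in> lq_space q" "y \<in> lq_space q" "z \<in> lq_space q"
        using that x bump_set_subset[OF q] unfolding B space by blast+
      with Metric_space.triangle''[OF Metric_space_lq[OF q1], of y x z]
      have "lq_norm q (\<lambda>n. y n - z n) \<le> lq_norm q (\<lambda>n. x n - y n) + lq_norm q (\<lambda>n. x n - z n)"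
        by simp
      then show ?thesis
        using that unfolding B by linarith
    qed
    \<comment> \<open>The levels of large height whose sign is not determined by the ball. With the
      threshold \<open>r / 8\<close>, the bound \<open>16 * r\<close> from two crossings becomes
      \<open>128 * (r / 8)\<close>.\<close>
    define T where "T = {k. height k \<ge> r / 8 \<and> (\<exists>y\<in>?B. \<exists>z\<in>?B. y (Suc k) * z (Suc k) < 0)}"
    have "height k' < 128 * (r / 8)" if k: "k \<in> T" "k' \<in> T" "k < k'" for k k'
    proof -
      obtain y z where yz: "y \<in> ?B" "z \<in> ?B" "y (Suc k) * z (Suc k) < 0"
        using k(1) unfolding T_def by blast
      obtain y' where y': "y' \<in> ?B" "y' (Suc k') \<noteq> 0"
        using k(2) unfolding T_def by fastforce
      have "height k' < 16 * r"
        using height_lt_of_two_crossings[OF q k(3) _ _ _ B2[OF yz(1,2)] B2[OF yz(1) y'(1)] yz(3) y'(2)]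
          yz y' unfolding B by blast
      then show ?thesis
        by simp
    qed
    then have T: "finite T" "card T \<le> 5"
      using card_height_le[of "r / 8" T] r by (simp_all add: T_def)
    \<comment> \<open>Parameters closer than \<open>w\<close> contribute at most
      \<open>w * C = r / 8\<close> to the distance; with another \<open>r / 8\<close> from the sign
      estimate, equally labelled points stay below \<open>r / 2\<close>.\<close>
    define w where "w = r / (8 * C)"
    have w: "w > 0" "r / w = 8 * C" "w * C = r / 8"
      using C r by (simp_all add: w_def)
    define F where "F y = (\<lfloor>y 0 / w\<rfloor>, {k \<in> T. y (Suc k) > 0})" for y :: "nat \<Rightarrow> real"
    define I where "I = {\<lfloor>x 0 / w\<rfloor> - \<lceil>8 * C\<rceil>..\<lfloor>x 0 / w\<rfloor> + \<lceil>8 * C\<rceil> + 1}"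
    have "card (I \<times> Pow T) = nat (2 * \<lceil>8 * C\<rceil> + 2) * 2 ^ card T"
      using T by (simp add: I_def card_cartesian_product card_Pow)
    also have "\<dots> \<le> N"
      unfolding N_def using T by (intro mult_left_mono power_increasing) simp_all
    finally have "card (I \<times> Pow T) \<le> N" .
    moreover have "F ` ?B \<subseteq> I \<times> Pow T"
    proof
      fix v assume "v \<in> F ` ?B"
      then obtain y where y: "y \<in> ?B" "v = F y"
        by blast
      have "\<bar>y 0 - x 0\<bar> < r"
        using abs_coordinate_diff_le[OF q, of x y 0] x y unfolding space B by linarith
      from floor_divide_mem_of_diff_less[OF this w(1)] have "\<lfloor>y 0 / w\<rfloor> \<in> I"
        by (simp only: I_def w(2))
      then show "v \<in> I \<times> Pow T"
        by (auto simp: y F_def)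
    qed
    moreover have "mdist ?m y z < r / 2" if yz: "y \<in> ?B" "z \<in> ?B" "F y = F z" for y z
    proof -
      obtain t s where y: "y = pt t s" "\<And>k. \<bar>s k\<bar> = 1"
        using yz(1)[unfolded B] unfolding bump_set_def by blast
      obtain u s' where z: "z = pt u s'" "\<And>k. \<bar>s' k\<bar> = 1"
        using yz(2)[unfolded B] unfolding bump_set_def by blast
      \<comment> \<open>A conflict at such a level would put it into \<open>T\<close>, where the
        second component of the label records the sign.\<close>
      have *: "y (Suc k) * z (Suc k) \<ge> 0" if "height k \<ge> r / 8" for k
      proof (rule ccontr)
        assume "\<not> y (Suc k) * z (Suc k) \<ge> 0"
        then have neg: "y (Suc k) * z (Suc k) < 0"
          by simp
        then have "k \<in> T"
          using that yz unfolding T_def by blast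
        then have "y (Suc k) > 0 \<longleftrightarrow> z (Suc k) > 0"
          using yz(3) by (auto simp: F_def)
        then show False
          using neg by (auto simp: mult_less_0_iff)
      qed
      have "lq_norm q (\<lambda>n. y n - z n) \<le> \<bar>t - u\<bar> * C + r / 8"
        using lq_norm_pt_diff_le_of_same_sign[of q s s' "r / 8" t u] q y z r * unfolding C_def by simp
      also have "\<bar>t - u\<bar> * C \<le> w * C"
        using floor_divide_eq_imp_diff_less[OF _ w(1), of t u] yz(3) C
        by (intro mult_right_mono) (simp_all add: F_def y z)
      finally show ?thesis
        using r w(3) by (simp add: mdist_lq_metric[OF q1])
    qed
    ultimately show "\<exists>(F :: (nat \<Rightarrow> real) \<Rightarrow> int \<times> nat set) V. finite V \<and> card V \<le> N \<and>
        F ` ?B \<subseteq> V \<and> (\<forall>y\<in>?B. \<forall>z\<in>?B. F y = F z \<longrightarrow> mdist ?m y z < r / 2)"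
      using T by (intro exI[of _ F] exI[of _ "I \<times> Pow T"] conjI ballI impI) (simp_all add: I_def)
  qed
qed


section \<open>Non-embeddability\<close>

text \<open>In each coordinate, the sides minus the diagonals give the square of
  \<open>a i + c i - b i - e i\<close>.\<close>

lemma L2_set_quadrilateral:
  "(L2_set (\<lambda>i. a i - c i) A)\<^sup>2 + (L2_set (\<lambda>i. b i - e i) A)\<^sup>2 \<le>
   (L2_set (\<lambda>i. a i - b i) A)\<^sup>2 + (L2_set (\<lambda>i. b i - c i) A)\<^sup>2 +
   (L2_set (\<lambda>i. a i - e i) A)\<^sup>2 + (L2_set (\<lambda>i. e i - c i) A)\<^sup>2"
proof -
  have sq: "(L2_set f A)\<^sup>2 = (\<Sum>i\<in>A. (f i)\<^sup>2)" for f :: "'a \<Rightarrow> real"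
    by (simp add: L2_set_def sum_nonneg)
  have "(a i - c i)\<^sup>2 + (b i - e i)\<^sup>2 \<le>
      (a i - b i)\<^sup>2 + (b i - c i)\<^sup>2 + (a i - e i)\<^sup>2 + (e i - c i)\<^sup>2" for i
    using zero_le_power2[of "a i + c i - b i - e i"] by (simp add: power2_eq_square algebra_simps)
  then show ?thesis
    unfolding sq sum.distrib[symmetric] by (rule sum_mono)
qed

section \<open>Subdivision of edges between 4-adic grid points\<close>

definition grid_pt :: "nat \<Rightarrow> int \<Rightarrow> (nat \<Rightarrow> real) \<Rightarrow> nat \<Rightarrow> real" where
  "grid_pt k m s = pt (real_of_int m / 4 ^ k) s"

lemma grid_pt_in_bump_set: "(\<And>k. \<bar>s k\<bar> = 1) \<Longrightarrow> grid_pt k m s \<in> bump_set"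
  by (auto simp: grid_pt_def bump_set_def)

lemma grid_pt_Suc: "grid_pt k m s = grid_pt (Suc k) (4 * m) s"
  by (simp add: grid_pt_def)

text \<open>Within a quarter period of an integer the tent of level \<open>k\<close> vanishes, so
  curves differing only in the sign \<open>s k\<close> coincide there. This glues the corners of the
  quadrilateral.\<close>

lemma grid_pt_update:
  assumes "\<bar>i - 4 * m\<bar> \<le> 1"
  shows "grid_pt (Suc k) i (s(k := c)) = grid_pt (Suc k) i s"
proof
  have "\<bar>real_of_int (i - 4 * m)\<bar> \<le> 1"
    using assms by linarith
  then have "\<bar>real_of_int i / 4 - of_int m\<bar> \<le> 1 / 4"
    by linarith
  moreover have "4 ^ k * (real_of_int i / 4 ^ Suc k) = real_of_int i / 4"
    by simp
  ultimately have "bump (4 ^ k * (real_of_int i / 4 ^ Suc k)) = 0"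
    using bump_quarter by simp
  then show "grid_pt (Suc k) i (s(k := c)) n = grid_pt (Suc k) i s n" for n
    unfolding grid_pt_def by (cases n) auto
qed

text \<open>A Laakso-type step: the edge of level \<open>k\<close> is replaced by two outer edges and a quadrilateral
  whose second diagonal has length proportional to \<open>height k\<close>. If no edge of the next level were
  stretched enough, the parallelogram inequality would make the first diagonal too short.\<close>

lemma edge_stretch_increment:
  fixes f :: "(nat \<Rightarrow> real) \<Rightarrow> 'i \<Rightarrow> real"
  assumes E_def: "\<And>x y. E x y = L2_set (\<lambda>i. f x i - f y i) A"
    and q: "q > 2" and r: "r > 0" and s: "\<And>k. \<bar>s k\<bar> = 1"
    and lower: "\<And>x y. x \<in> bump_set \<Longrightarrow> y \<in> bump_set \<Longrightarrow> r * lq_norm q (\<lambda>n. x n - y n) \<le> E x y"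
  obtains m' s' where "\<And>k. \<bar>s' k\<bar> = 1"
    and "(4 ^ Suc k * E (grid_pt (Suc k) m' s') (grid_pt (Suc k) (m' + 1) s'))\<^sup>2 \<ge>
      (4 ^ k * E (grid_pt k m s) (grid_pt k (m + 1) s))\<^sup>2 + r\<^sup>2 * (slope k)\<^sup>2 / 2"
proof (rule ccontr)
  note result = that
  define h :: real where "h = 4 ^ Suc k"
  define a where "a = 4 ^ k * E (grid_pt k m s) (grid_pt k (m + 1) s)"
  define \<delta> where "\<delta> = r\<^sup>2 * (slope k)\<^sup>2 / 2"
  define P where "P = (\<lambda>i s. grid_pt (Suc k) (4 * m + i) s)"
  define u v where "u = s(k := 1)" and "v = s(k := - 1)"
  assume "\<not> thesis"
  \<comment> \<open>If the conclusion fails, every edge of level \<open>Suc k\<close> is short, for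
    all signs: the two outer edges as well as the four sides, taken on the curves \<open>u\<close>
    and \<open>v\<close>.\<close>
  have small: "(h * E (P i s') (P (i + 1) s'))\<^sup>2 < a\<^sup>2 + \<delta>" if s': "\<And>k. \<bar>s' k\<bar> = 1" for i s'
  proof (rule ccontr)
    assume "\<not> (h * E (P i s') (P (i + 1) s'))\<^sup>2 < a\<^sup>2 + \<delta>"
    then have "a\<^sup>2 + \<delta> \<le> (h * E (P i s') (P (i + 1) s'))\<^sup>2"
      by simp
    then have thesis
      unfolding a_def \<delta>_def h_def P_def
      by (intro result[of s' "4 * m + i"] s') (simp only: add.assoc)
    with \<open>\<not> thesis\<close> show False ..
  qed
  have uv: "\<And>k. \<bar>u k\<bar> = 1" "\<And>k. \<bar>v k\<bar> = 1"
    using s by (simp_all add: u_def v_def)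
  have glue: "P 1 u = P 1 s" "P 1 v = P 1 s" "P 3 u = P 3 s" "P 3 v = P 3 s"
    unfolding P_def u_def v_def
    using grid_pt_update[of "4 * m + 1" m k s] grid_pt_update[of "4 * m + 3" "m + 1" k s] by simp_all
  have ends: "grid_pt k m s = P 0 s" "grid_pt k (m + 1) s = P 4 s"
    unfolding P_def grid_pt_Suc[of k] by (simp_all add: algebra_simps)
  have h: "h > 0"
    by (simp add: h_def)
  have tri: "E x z \<le> E x y + E y z" for x y z
    unfolding E_def using L2_set_triangle_ineq[of "\<lambda>i. f x i - f y i" "\<lambda>i. f y i - f z i" A] by simp
  define W where "W = h * E (P 1 s) (P 3 s)"
  define V where "V = h * E (P 2 u) (P 2 v)"
  define z1 where "z1 = h * E (P 0 s) (P 1 s)"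
  define z2 where "z2 = h * E (P 3 s) (P 4 s)"
  have z: "z1\<^sup>2 < a\<^sup>2 + \<delta>" "z2\<^sup>2 < a\<^sup>2 + \<delta>"
    using small[of s 0] small[of s 3] s by (simp_all add: z1_def z2_def)
  have four: "w + x + y + z < 4 * b" if "w < b" "x < b" "y < b" "z < b" for w x y z b :: real
    using that by linarith
  have "W\<^sup>2 + V\<^sup>2 = h\<^sup>2 * ((E (P 1 s) (P 3 s))\<^sup>2 + (E (P 2 u) (P 2 v))\<^sup>2)"
    by (simp add: W_def V_def power_mult_distrib distrib_left)
  also have "\<dots> \<le> h\<^sup>2 * ((E (P 1 s) (P 2 u))\<^sup>2 + (E (P 2 u) (P 3 s))\<^sup>2 +
      (E (P 1 s) (P 2 v))\<^sup>2 + (E (P 2 v) (P 3 s))\<^sup>2)"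
    unfolding E_def by (intro mult_left_mono L2_set_quadrilateral) simp
  also have "\<dots> = (h * E (P 1 u) (P (1 + 1) u))\<^sup>2 + (h * E (P 2 u) (P (2 + 1) u))\<^sup>2 +
      (h * E (P 1 v) (P (1 + 1) v))\<^sup>2 + (h * E (P 2 v) (P (2 + 1) v))\<^sup>2"
    by (simp add: glue power_mult_distrib distrib_left)
  also have "\<dots> < 4 * (a\<^sup>2 + \<delta>)"
    by (intro four small uv)
  finally have quad: "W\<^sup>2 + V\<^sup>2 < 4 * (a\<^sup>2 + \<delta>)" .
  \<comment> \<open>At the midpoint the tent has its maximum 1/4, so the two signs are
    \<open>height k / 2\<close> apart in one coordinate; multiplying by \<open>h = 4 ^ Suc k\<close>
    gives \<open>2 * slope k\<close>.\<close>
  have "2 * r * slope k \<le> V"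
  proof -
    have "4 ^ k * (real_of_int (4 * m + 2) / 4 ^ Suc k) = of_int m + 1 / 2"
      by (simp add: field_simps)
    then have "bump (4 ^ k * (real_of_int (4 * m + 2) / 4 ^ Suc k)) = 1 / 4"
      by (simp only: bump_half)
    then have "\<bar>P 2 u (Suc k) - P 2 v (Suc k)\<bar> = height k / 2"
      using height_pos[of k] unfolding P_def grid_pt_def by (simp add: u_def v_def del: power_Suc)
    then have "height k / 2 \<le> lq_norm q (\<lambda>n. P 2 u n - P 2 v n)"
      using abs_coordinate_diff_le[OF q, of "P 2 u" "P 2 v" "Suc k"] uv
      by (simp add: P_def grid_pt_in_bump_set)
    then have "r * (height k / 2) \<le> r * lq_norm q (\<lambda>n. P 2 u n - P 2 v n)"
      using r by simp
    also have "\<dots> \<le> E (P 2 u) (P 2 v)"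
      unfolding P_def by (intro lower grid_pt_in_bump_set uv)
    finally have "h * (r * (height k / 2)) \<le> V"
      unfolding V_def using h by simp
    then show ?thesis
      by (simp add: h_def height_def)
  qed
  then have "(2 * r * slope k)\<^sup>2 \<le> V\<^sup>2"
    using r slope_pos[of k] by (intro power_mono) simp_all
  then have V: "8 * \<delta> \<le> V\<^sup>2"
    by (simp add: \<delta>_def power_mult_distrib)
  have "4 * a \<le> z1 + W + z2"
  proof -
    have "E (P 0 s) (P 4 s) \<le> E (P 0 s) (P 1 s) + E (P 1 s) (P 3 s) + E (P 3 s) (P 4 s)"
      using tri[of "P 0 s" "P 4 s" "P 1 s"] tri[of "P 1 s" "P 4 s" "P 3 s"] by linarith
    then have "h * E (P 0 s) (P 4 s) \<le> h * (E (P 0 s) (P 1 s) + E (P 1 s) (P 3 s) + E (P 3 s) (P 4 s))"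
      using h by simp
    then show ?thesis
      by (simp add: a_def ends z1_def z2_def W_def distrib_left h_def)
  qed
  moreover have "0 \<le> 4 * a"
    by (simp add: a_def E_def)
  ultimately have "(4 * a)\<^sup>2 \<le> (z1 + W + z2)\<^sup>2"
    by (intro power_mono)
  \<comment> \<open>Cauchy-Schwarz with weights 1/4, 1/4, 1/2, the parameter shares of the three
    pieces. The bounds \<open>z\<close> give \<open>8 * (a\<^sup>2 + \<delta>)\<close> for the outer
    edges, and \<open>quad\<close> with \<open>V\<close> gives
    \<open>2 * W\<^sup>2 < 8 * a\<^sup>2 - 8 * \<delta>\<close>, so the \<open>\<delta>\<close>
    terms cancel.\<close>
  also have "\<dots> \<le> 4 * z1\<^sup>2 + 4 * z2\<^sup>2 + 2 * W\<^sup>2"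
    using zero_le_power2[of "z1 + z2 - W"] zero_le_power2[of "z1 - z2"]
    by (simp add: power2_eq_square algebra_simps)
  also have "\<dots> < 16 * a\<^sup>2"
    using z quad V by argo
  finally show False
    by (simp add: power_mult_distrib)
qed

text \<open>Iterating the increment makes the squared normalized stretch of some edge of level
  \<open>n\<close> at least \<open>r\<^sup>2 / 2\<close> times the partial sum of the squared
  slopes, while the upper bound on \<open>E\<close> caps it uniformly in \<open>n\<close>. The index
  set \<open>A\<close> is arbitrary, so one argument covers all dimensions.\<close>

lemma no_euclidean_embedding_bump_set:
  fixes f :: "(nat \<Rightarrow> real) \<Rightarrow> 'i \<Rightarrow> real"
  assumes E_def: "\<And>x y. E x y = L2_set (\<lambda>i. f x i - f y i) A"
    and q: "q > 2" and r: "r > 0"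
    and lower: "\<And>x y. x \<in> bump_set \<Longrightarrow> y \<in> bump_set \<Longrightarrow> r * lq_norm q (\<lambda>n. x n - y n) \<le> E x y"
    and upper: "\<And>x y. x \<in> bump_set \<Longrightarrow> y \<in> bump_set \<Longrightarrow> E x y \<le> M * lq_norm q (\<lambda>n. x n - y n)"
  shows False
proof -
  have grow: "\<exists>m s. (\<forall>k. \<bar>s k\<bar> = 1) \<and>
      r\<^sup>2 / 2 * (\<Sum>k<n. (slope k)\<^sup>2) \<le> (4 ^ n * E (grid_pt n m s) (grid_pt n (m + 1) s))\<^sup>2" for n
  proof (induction n)
    case 0
    show ?case
      by (intro exI[of _ 0] exI[of _ "\<lambda>_. 1"]) simp
  next
    case (Suc n)
    then obtain m s where s: "\<And>k. \<bar>s k\<bar> = 1"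
      and IH: "r\<^sup>2 / 2 * (\<Sum>k<n. (slope k)\<^sup>2) \<le> (4 ^ n * E (grid_pt n m s) (grid_pt n (m + 1) s))\<^sup>2"
      by blast
    obtain m' s' where s': "\<And>k. \<bar>s' k\<bar> = 1"
      and "(4 ^ Suc n * E (grid_pt (Suc n) m' s') (grid_pt (Suc n) (m' + 1) s'))\<^sup>2 \<ge>
        (4 ^ n * E (grid_pt n m s) (grid_pt n (m + 1) s))\<^sup>2 + r\<^sup>2 * (slope n)\<^sup>2 / 2"
      using edge_stretch_increment[where s = s and k = n and m = m, OF E_def q r s lower] by blast
    with IH have "r\<^sup>2 / 2 * (\<Sum>k<Suc n. (slope k)\<^sup>2) \<le>
        (4 ^ Suc n * E (grid_pt (Suc n) m' s') (grid_pt (Suc n) (m' + 1) s'))\<^sup>2"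
      by (simp add: distrib_left)
    with s' show ?case
      by blast
  qed
  define C where "C = lq_norm q modulus"
  have bound: "(\<Sum>k<n. (slope k)\<^sup>2) \<le> 2 * (\<bar>M\<bar> * C)\<^sup>2 / r\<^sup>2" for n
  proof -
    obtain m s where s: "\<And>k. \<bar>s k\<bar> = 1"
      and le: "r\<^sup>2 / 2 * (\<Sum>k<n. (slope k)\<^sup>2) \<le> (4 ^ n * E (grid_pt n m s) (grid_pt n (m + 1) s))\<^sup>2"
      using grow[of n] by blast
    \<comment> \<open>Both endpoints lie on the same signed curve, with parameters
      \<open>1 / 4 ^ n\<close> apart; the normalization by \<open>4 ^ n\<close> cancels this
      factor.\<close>
    have "lq_norm q (\<lambda>i. grid_pt n m s i - grid_pt n (m + 1) s i) \<le> C / 4 ^ n"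
      unfolding grid_pt_def C_def
      using lq_norm_pt_diff_le(2)[of q s "real_of_int m / 4 ^ n" "real_of_int (m + 1) / 4 ^ n"] q s
      by (simp add: add_divide_distrib)
    then have "\<bar>M\<bar> * lq_norm q (\<lambda>i. grid_pt n m s i - grid_pt n (m + 1) s i) \<le> \<bar>M\<bar> * (C / 4 ^ n)"
      by (intro mult_left_mono) simp_all
    moreover have "M * lq_norm q (\<lambda>i. grid_pt n m s i - grid_pt n (m + 1) s i) \<le>
        \<bar>M\<bar> * lq_norm q (\<lambda>i. grid_pt n m s i - grid_pt n (m + 1) s i)"
      by (intro mult_right_mono lq_norm_nonneg) simp
    ultimately have "E (grid_pt n m s) (grid_pt n (m + 1) s) \<le> \<bar>M\<bar> * (C / 4 ^ n)"
      using upper[of "grid_pt n m s" "grid_pt n (m + 1) s"] grid_pt_in_bump_set[of s n] s by fastforce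
    then have "4 ^ n * E (grid_pt n m s) (grid_pt n (m + 1) s) \<le> \<bar>M\<bar> * C"
      by (simp add: field_simps)
    then have "(4 ^ n * E (grid_pt n m s) (grid_pt n (m + 1) s))\<^sup>2 \<le> (\<bar>M\<bar> * C)\<^sup>2"
      by (intro power_mono) (simp_all add: E_def)
    with le have "r\<^sup>2 / 2 * (\<Sum>k<n. (slope k)\<^sup>2) \<le> (\<bar>M\<bar> * C)\<^sup>2"
      by (rule order_trans)
    then show ?thesis
      using r by (simp add: field_simps)
  qed
  \<comment> \<open>Bounded partial sums would make the squared slopes summable, but they form the
    harmonic series.\<close>
  have "summable (\<lambda>k. (slope k)\<^sup>2)"
    using bound by (intro summableI_nonneg_bounded) simp_all
  moreover have "(slope k)\<^sup>2 = inverse (real (Suc k))" for k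
    by (simp add: slope_def power_divide inverse_eq_divide)
  ultimately have "summable (\<lambda>k. inverse (real k))"
    using summable_Suc_iff[of "\<lambda>k. inverse (real k)"] by simp
  then show False
    using not_summable_harmonic[where 'a = real] by simp
qed

theorem theorem1:
  fixes q :: real
  assumes "q > 2"
  shows "\<exists>S \<subseteq> mspace (lq_metric q).
           doubling (submetric (lq_metric q) S) \<and>
           (\<forall>d::nat. \<not> (\<exists>f. bilipschitz_embedding (submetric (lq_metric q) S) (Rd_metric d) f))"
proof (intro exI[of _ bump_set] conjI allI notI)
  have q1: "q \<ge> 1"
    using assms by simp
  show sub: "bump_set \<subseteq> mspace (lq_metric q)"
    using bump_set_subset[OF assms] by (simp add: mspace_lq_metric[OF q1])
  show "doubling (submetric (lq_metric q) bump_set)"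
    using assms by (rule doubling_bump_set)
  fix d :: nat
  assume "\<exists>f. bilipschitz_embedding (submetric (lq_metric q) bump_set) (Rd_metric d) f"
  then obtain f where f: "bilipschitz_embedding (submetric (lq_metric q) bump_set) (Rd_metric d) f" ..
  have "\<exists>r D. r > 0 \<and> D \<ge> 1 \<and> (\<forall>x\<in>bump_set. \<forall>y\<in>bump_set.
      r * lq_norm q (\<lambda>n. x n - y n) \<le> L2_set (\<lambda>i. f x i - f y i) {..<d} \<and>
      L2_set (\<lambda>i. f x i - f y i) {..<d} \<le> r * D * lq_norm q (\<lambda>n. x n - y n))"
    using f unfolding bilipschitz_embedding_def mspace_submetric mdist_submetric
      mdist_lq_metric[OF q1] mdist_Rd_metric Int_absorb2[OF sub] by (rule conjunct2)
  then obtain r D where "r > 0"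
    and bounds: "\<forall>x\<in>bump_set. \<forall>y\<in>bump_set.
      r * lq_norm q (\<lambda>n. x n - y n) \<le> L2_set (\<lambda>i. f x i - f y i) {..<d} \<and>
      L2_set (\<lambda>i. f x i - f y i) {..<d} \<le> r * D * lq_norm q (\<lambda>n. x n - y n)"
    by blast
  then show False
    using no_euclidean_embedding_bump_set[OF refl assms, of r f "{..<d}" "r * D"] by blast
qed

end
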